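(* Let $M$ be an $n\times n$ $k$-uniform binary matrix. Then $M$ is optimal if and only if the canonical word $w_j$ of $M$ is a Dyck word for every $j$ with $1\le j\le n-1$.
   Context: Biker–hiker model: $n$ travellers $t_1,\dots,t_n$; posts $P_0,\dots,P_n$ at unit spacing; stage $s_j$ is the leg from $P_{j-1}$ to $P_j$. All start at $P_0$ at time $0$, walk at common speed $w$, cycle at common speed $v>w$, mode changes take no time. The $n\times n$ binary matrix $M=(m_{i,j})$ prescribes that $t_i$ cycles $s_j$ iff $m_{i,j}=1$. $M$ is $k$-uniform if every row and column has exactly $k$ ones. Bicycles start at $P_0$, move only when ridden by one rider, and a traveller due to cycle $s_j$ must take a bicycle present at $P_{j-1}$ when he arrives there. $M$ is optimal if it is $k$-uniform for some $k$ and, with $k$ bicycles, the scheme can be executed with no traveller ever waiting for a bicycle. Canonical word: for $1\le j\le n-1$ let $S_{i,j}=\sum_{l=1}^{j}m_{i,l}$, $X_{1,0}^j=\{i:m_{i,j}=1,m_{i,j+1}=0\}$, $X_{0,1}^j=\{i:m_{i,j}=0,m_{i,j+1}=1\}$ (these have the same size $p$ when $M$ is uniform). List the $2p$ elements of $X_{1,0}^j\cup X_{0,1}^j$ in non-increasing order of $S_{i,j}$, where among elements with equal sums those of $X_{1,0}^j$ precede those of $X_{0,1}^j$ (ties within one set broken by index). The canonical word $w_j$ is the word over $\{a,b\}$ whose $r$-th letter is $a$ if the $r$-th listed element lies in $X_{1,0}^j$ and $b$ if it lies in $X_{0,1}^j$. A word $w$ over $\{a,b\}$ is a Dyck word if it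 has equally many $a$'s and $b$'s and every prefix $u$ of $w$ has at least as many $a$'s as $b$'s. *)

theory Defs
  imports Complex_Main "HOL-Library.Sublist" "Jordan_Normal_Form.Matrix"
begin

text \<open>
  Indices: travellers are \<open>0, \<dots>, n - 1\<close>, posts are \<open>0, \<dots>, n\<close>, and column \<open>j < n\<close> of the matrix
  describes the leg from post \<open>j\<close> to post \<open>j + 1\<close>.  So traveller and stage indices are shifted
  down by one with respect to \<open>t\<^sub>1, \<dots>, t\<^sub>n\<close> and \<open>s\<^sub>1, \<dots>, s\<^sub>n\<close>, while post indices are not.
\<close>

definition binary_mat :: "nat \<Rightarrow> nat mat \<Rightarrow> bool" where
  "binary_mat n M \<longleftrightarrow> M \<in> carrier_mat n n \<and> elements_mat M \<subseteq> {0, 1}"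

definition uniform_mat :: "nat \<Rightarrow> nat \<Rightarrow> nat mat \<Rightarrow> bool" where
  "uniform_mat n k M \<longleftrightarrow> binary_mat n M \<and>
     (\<forall>i<n. card {j. j < n \<and> M $$ (i, j) = 1} = k) \<and>
     (\<forall>j<n. card {i. i < n \<and> M $$ (i, j) = 1} = k)"


subsection \<open>Execution of a scheme\<close>

text \<open>
  A run is given by the time \<open>arr i j\<close> at which traveller \<open>i\<close> arrives at post \<open>j\<close>, the time
  \<open>dep i j\<close> at which he leaves it, and the bicycle \<open>bike i j\<close> he rides from post \<open>j\<close> to post
  \<open>j + 1\<close> (only relevant if \<open>M $$ (i, j) = 1\<close>).

  Bicycle \<open>b\<close> stands at post \<open>j\<close> at time \<open>t\<close> if by then it has been brought there (all bicycles
  are at post 0 initially) and nobody has ridden it away before \<open>t\<close>.  Riders only move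
  forward, so a bicycle that has left a post never comes back to it.
\<close>

definition bike_at ::
  "nat \<Rightarrow> nat mat \<Rightarrow> (nat \<Rightarrow> nat \<Rightarrow> real) \<Rightarrow> (nat \<Rightarrow> nat \<Rightarrow> real) \<Rightarrow> (nat \<Rightarrow> nat \<Rightarrow> nat)
    \<Rightarrow> nat \<Rightarrow> nat \<Rightarrow> real \<Rightarrow> bool" where
  "bike_at n M arr dep bike b j t \<longleftrightarrow>
     (j = 0 \<or> (\<exists>i<n. M $$ (i, j - 1) = 1 \<and> bike i (j - 1) = b \<and> arr i j \<le> t)) \<and>
     (\<forall>i<n. M $$ (i, j) = 1 \<and> bike i j = b \<longrightarrow> t \<le> dep i j)"

text \<open>
  In the last conjunct, two travellers riding the same bicycle on the same stage would have to
  set off together; this is what the restriction to one rider excludes.  Only a traveller who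
  is about to cycle may delay his departure.
\<close>

definition execution ::
  "real \<Rightarrow> real \<Rightarrow> nat \<Rightarrow> nat \<Rightarrow> nat mat
    \<Rightarrow> (nat \<Rightarrow> nat \<Rightarrow> real) \<Rightarrow> (nat \<Rightarrow> nat \<Rightarrow> real) \<Rightarrow> (nat \<Rightarrow> nat \<Rightarrow> nat) \<Rightarrow> bool" where
  "execution v w n k M arr dep bike \<longleftrightarrow>
     (\<forall>i<n. arr i 0 = 0) \<and>
     (\<forall>i<n. \<forall>j<n. arr i (Suc j) = dep i j + 1 / (if M $$ (i, j) = 1 then v else w)) \<and>
     (\<forall>i<n. \<forall>j<n. if M $$ (i, j) = 1 then arr i j \<le> dep i j else dep i j = arr i j) \<and>
     (\<forall>i<n. \<forall>j<n. M $$ (i, j) = 1 \<longrightarrow>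
        bike i j < k \<and> bike_at n M arr dep bike (bike i j) j (dep i j)) \<and>
     (\<forall>i<n. \<forall>i'<n. \<forall>j<n. M $$ (i, j) = 1 \<and> M $$ (i', j) = 1 \<and> i \<noteq> i' \<longrightarrow>
        \<not> (bike i j = bike i' j \<and> dep i j = dep i' j))"

definition no_waiting ::
  "nat \<Rightarrow> (nat \<Rightarrow> nat \<Rightarrow> real) \<Rightarrow> (nat \<Rightarrow> nat \<Rightarrow> real) \<Rightarrow> bool" where
  "no_waiting n arr dep \<longleftrightarrow> (\<forall>i<n. \<forall>j<n. dep i j = arr i j)"

definition optimal :: "real \<Rightarrow> real \<Rightarrow> nat \<Rightarrow> nat mat \<Rightarrow> bool" where
  "optimal v w n M \<longleftrightarrow>
     (\<exists>k. uniform_mat n k M \<and>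
        (\<exists>arr dep bike. execution v w n k M arr dep bike \<and> no_waiting n arr dep))"


subsection \<open>Canonical words\<close>

datatype letter = a | b

text \<open>
  Below, \<open>j\<close> is a post with \<open>1 \<le> j \<le> n - 1\<close>: columns \<open>j - 1\<close> and \<open>j\<close> are the legs that end and
  begin there.
\<close>

definition S :: "nat mat \<Rightarrow> nat \<Rightarrow> nat \<Rightarrow> nat" where
  "S M i j = (\<Sum>l<j. M $$ (i, l))"

definition X10 :: "nat \<Rightarrow> nat mat \<Rightarrow> nat \<Rightarrow> nat set" where
  "X10 n M j = {i. i < n \<and> M $$ (i, j - 1) = 1 \<and> M $$ (i, j) = 0}"

definition X01 :: "nat \<Rightarrow> nat mat \<Rightarrow> nat \<Rightarrow> nat set" where
  "X01 n M j = {i. i < n \<and> M $$ (i, j - 1) = 0 \<and> M $$ (i, j) = 1}"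

text \<open>
  \<^const>\<open>sort_key\<close> is stable, so among equal sums the elements of \<^const>\<open>X10\<close> stay in front
  of those of \<^const>\<open>X01\<close>, and within each set the order by index is kept.
\<close>

definition canonical_list :: "nat \<Rightarrow> nat mat \<Rightarrow> nat \<Rightarrow> nat list" where
  "canonical_list n M j =
     sort_key (\<lambda>i. - int (S M i j))
       (sorted_list_of_set (X10 n M j) @ sorted_list_of_set (X01 n M j))"

definition canonical_word :: "nat \<Rightarrow> nat mat \<Rightarrow> nat \<Rightarrow> letter list" where
  "canonical_word n M j = map (\<lambda>i. if i \<in> X10 n M j then a else b) (canonical_list n M j)"

definition dyck_word :: "letter list \<Rightarrow> bool" where
  "dyck_word x \<longleftrightarrow> count_list x a = count_list x b \<and>
     (\<forall>u. prefix u x \<longrightarrow> count_list u b \<le> count_list u a)"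

end

theory Submission
  imports Defs
begin

text \<open>
  Without waiting, traveller \<open>i\<close> reaches post \<open>j\<close> at a time that strictly decreases in
  \<open>S M i j\<close>.  No two riders of a stage share a bicycle, so passing on the bicycles at post \<open>j\<close> is
  an injection from the riders of column \<open>j\<close> into those of column \<open>j - 1\<close> under which \<open>S\<close> does not
  decrease.  Such an injection exists iff, for every threshold \<open>s\<close>, at least as many riders with
  \<open>S M i j \<ge> s\<close> end a stage at \<open>j\<close> as begin one.  The travellers who cycle on both sides of \<open>j\<close>
  contribute equally to both counts, so only \<open>X10\<close> and \<open>X01\<close> matter, and the resulting
  inequalities say exactly that the canonical word is a Dyck word.
\<close>

section \<open>Injections that do not decrease a value\<close>

text \<open>Hall's condition for nested neighbourhoods. Conversely to the easy direction, remove an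
  element \<open>x\<close> of \<open>B\<close> with least \<open>f x\<close> and place the others by
  induction. All of \<open>B\<close> lies above the threshold \<open>f x\<close>, so the inequality
  there leaves an element of \<open>A\<close> above \<open>f x\<close> that is still free for
  \<open>x\<close>.\<close>

lemma ex_inj_on_ge_iff:
  fixes f :: "'a \<Rightarrow> 'b::linorder"
  assumes "finite A" "finite B"
  shows "(\<exists>g. inj_on g B \<and> g ` B \<subseteq> A \<and> (\<forall>x\<in>B. f x \<le> f (g x))) \<longleftrightarrow>
    (\<forall>s. card {x \<in> B. s \<le> f x} \<le> card {x \<in> A. s \<le> f x})"
proof
  assume "\<exists>g. inj_on g B \<and> g ` B \<subseteq> A \<and> (\<forall>x\<in>B. f x \<le> f (g x))"
  then obtain g where g: "inj_on g B" "g ` B \<subseteq> A" "\<And>x. x \<in> B \<Longrightarrow> f x \<le> f (g x)"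
    by blast
  show "\<forall>s. card {x \<in> B. s \<le> f x} \<le> card {x \<in> A. s \<le> f x}"
  proof
    fix s
    show "card {x \<in> B. s \<le> f x} \<le> card {x \<in> A. s \<le> f x}"
    proof (rule card_inj_on_le)
      show "inj_on g {x \<in> B. s \<le> f x}"
        using g(1) by (rule inj_on_subset) auto
      show "g ` {x \<in> B. s \<le> f x} \<subseteq> {x \<in> A. s \<le> f x}"
        using g(2,3) order_trans by fastforce
    qed (use assms in auto)
  qed
next
  show "\<exists>g. inj_on g B \<and> g ` B \<subseteq> A \<and> (\<forall>x\<in>B. f x \<le> f (g x))"
    if "\<forall>s. card {x \<in> B. s \<le> f x} \<le> card {x \<in> A. s \<le> f x}"
    using assms(2) that
  proof (induction "card B" arbitrary: B)
    case 0
    then show ?case by auto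
  next
    case (Suc m)
    then have "B \<noteq> {}" by auto
    define x where "x = arg_min_on f B"
    have x: "x \<in> B" "\<And>y. y \<in> B \<Longrightarrow> f x \<le> f y"
      using \<open>B \<noteq> {}\<close> \<open>finite B\<close> by (auto simp: x_def arg_min_if_finite arg_min_least)
    have "card {y \<in> B - {x}. s \<le> f y} \<le> card {y \<in> A. s \<le> f y}" for s
    proof -
      have "card {y \<in> B - {x}. s \<le> f y} \<le> card {y \<in> B. s \<le> f y}"
        using \<open>finite B\<close> by (intro card_mono) auto
      then show ?thesis using Suc.prems(2) order_trans by blast
    qed
    moreover have "m = card (B - {x})" using Suc.hyps(2) x(1) by simp
    ultimately obtain g where g: "inj_on g (B - {x})" "g ` (B - {x}) \<subseteq> A"
      "\<And>y. y \<in> B - {x} \<Longrightarrow> f y \<le> f (g y)"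
      using Suc.hyps(1)[of "B - {x}"] \<open>finite B\<close> by (metis finite_Diff)
    have "card (g ` (B - {x})) < card B"
      using g(1) x(1) Suc.hyps(2) \<open>finite B\<close> by (simp add: card_image)
    also have "card B = card {y \<in> B. f x \<le> f y}"
      using x(2) by (intro arg_cong[of _ _ card]) auto
    also have "\<dots> \<le> card {y \<in> A. f x \<le> f y}" using Suc.prems(2) by blast
    finally have "\<not> {y \<in> A. f x \<le> f y} \<subseteq> g ` (B - {x})"
      using card_mono[of "g ` (B - {x})" "{y \<in> A. f x \<le> f y}"] \<open>finite B\<close> by auto
    then obtain y where y: "y \<in> A" "f x \<le> f y" "y \<notin> g ` (B - {x})" by blast
    have "inj_on (g(x := y)) B"
      using g(1) y(3) x(1) by (auto simp: inj_on_def)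
    moreover have "(g(x := y)) ` B \<subseteq> A" using g(2) y(1) by auto
    moreover have "\<forall>z\<in>B. f z \<le> f ((g(x := y)) z)" using g(3) y(2) by auto
    ultimately show ?case by blast
  qed
qed

section \<open>Balance in prefixes of a stably sorted list\<close>

lemma prefix_map_iff: "prefix u (map h xs) \<longleftrightarrow> (\<exists>v. prefix v xs \<and> u = map h v)"
  by (auto simp: prefix_def map_eq_append_conv append_eq_map_conv)

lemma prefix_filter_le_sorted:
  assumes "sorted (map f xs)"
  shows "prefix (filter (\<lambda>x. f x \<le> c) xs) xs"
  using assms
proof (induction xs)
  case (Cons x xs)
  show ?case
  proof (cases "f x \<le> c")
    case False
    then have "filter (\<lambda>x. f x \<le> c) (x # xs) = []"
      using Cons.prems by (auto simp: filter_empty_conv)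
    then show ?thesis by simp
  qed (use Cons in auto)
qed simp

text \<open>Within a block of equal keys stability puts \<open>xs\<close> before \<open>ys\<close>,
  so the surplus of \<open>xs\<close> over \<open>ys\<close> first rises and then falls. It is
  therefore smallest at the ends of blocks, and the prefixes that end there are the sets
  \<open>f x \<le> c\<close>.\<close>

lemma prefix_sort_key_balance_iff:
  fixes f :: "'a \<Rightarrow> int"
  assumes "distinct (xs @ ys)"
  shows "(\<forall>u. prefix u (sort_key f (xs @ ys)) \<longrightarrow> card (set u \<inter> set ys) \<le> card (set u \<inter> set xs)) \<longleftrightarrow>
    (\<forall>c. card {x \<in> set ys. f x \<le> c} \<le> card {x \<in> set xs. f x \<le> c})"
    (is "?L \<longleftrightarrow> ?R")
proof
  assume L: ?L
  show ?R
  proof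
    fix c
    let ?u = "filter (\<lambda>x. f x \<le> c) (sort_key f (xs @ ys))"
    have "card (set ?u \<inter> set ys) \<le> card (set ?u \<inter> set xs)"
      using L prefix_filter_le_sorted[of f "sort_key f (xs @ ys)" c] sorted_sort_key by blast
    moreover have "set ?u \<inter> set ys = {x \<in> set ys. f x \<le> c}"
      "set ?u \<inter> set xs = {x \<in> set xs. f x \<le> c}"
      by auto
    ultimately show "card {x \<in> set ys. f x \<le> c} \<le> card {x \<in> set xs. f x \<le> c}" by simp
  qed
next
  assume R: ?R
  show ?L
  proof (intro allI impI)
    fix u
    assume "prefix u (sort_key f (xs @ ys))"
    then obtain z where z: "sort_key f (xs @ ys) = u @ z" by (auto simp: prefix_def)
    have set_uz: "set u \<union> set z = set xs \<union> set ys"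
      using arg_cong[OF z, of set] by simp
    have sorted: "sorted (map f u @ map f z)"
      using sorted_sort_key[of f "xs @ ys"] z by simp
    show "card (set u \<inter> set ys) \<le> card (set u \<inter> set xs)"
    proof (cases "u = []")
      case False
      define c where "c = f (last u)"
      have u_le: "f x \<le> c" if "x \<in> set u" for x
      proof -
        have "u = butlast u @ [last u]" using False by simp
        then have "x \<in> set (butlast u) \<or> x = last u"
          using that by (metis Un_iff empty_iff insert_iff list.set set_append)
        moreover have "sorted (map f (butlast u @ [last u]))"
          using sorted False by (simp add: sorted_append)
        ultimately show ?thesis by (auto simp: c_def sorted_append)
      qed
      have z_ge: "c \<le> f x" if "x \<in> set z" for x
        using sorted that False by (auto simp: c_def sorted_append)
      \<comment> \<open>If \<open>u\<close> has reached the \<open>ys\<close> part of the block with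
        key \<open>c\<close>, it already contains all \<open>xs\<close> of that block, and the bound
        at \<open>c\<close> applies. Otherwise the block adds no \<open>ys\<close> to
        \<open>u\<close>, and the bound for the earlier blocks suffices; as keys are integers, these
        are given by \<open>c - 1\<close>.\<close>
      show ?thesis
      proof (cases "\<exists>y \<in> set u \<inter> set ys. f y = c")
        case True
        then obtain y where y: "y \<in> set u" "y \<in> set ys" "f y = c" by blast
        \<comment> \<open>By stability all of \<open>xs\<close> with key \<open>c\<close> comes before \<open>y\<close>.\<close>
        have tie: "x \<notin> set z" if "x \<in> set xs" "f x = c" for x
        proof
          assume "x \<in> set z"
          let ?F = "filter (\<lambda>y. f y = c)"
          have "?F (u @ z) = ?F (xs @ ys)"
            using sort_key_stable[of f c "xs @ ys"] z by simp
          then have "?F u @ ?F z = ?F xs @ ?F ys" by simp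
          \<comment> \<open>The same list is cut in two ways. Whichever cut comes first, either the
            part in \<open>z\<close> lies within \<open>ys\<close> or the part in \<open>u\<close>
            lies within \<open>xs\<close>; the first is refuted by \<open>x\<close>, the second by
            \<open>y\<close>.\<close>
          then obtain us where "?F u = ?F xs @ us \<and> us @ ?F z = ?F ys \<or>
              ?F u @ us = ?F xs \<and> ?F z = us @ ?F ys"
            by (auto simp: append_eq_append_conv2)
          then have "set (?F z) \<subseteq> set (?F ys) \<or> set (?F u) \<subseteq> set (?F xs)"
            by (metis inf_sup_ord(3,4) set_append)
          then have "x \<in> set ys \<or> y \<in> set xs"
            using \<open>x \<in> set z\<close> y that by auto
          then show False using that y assms by auto
        qed
        have "card (set u \<inter> set ys) \<le> card {x \<in> set ys. f x \<le> c}"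
          using u_le by (intro card_mono) auto
        also have "\<dots> \<le> card {x \<in> set xs. f x \<le> c}" using R by blast
        also have "\<dots> \<le> card (set u \<inter> set xs)"
          using set_uz z_ge tie by (intro card_mono) (auto, force)
        finally show ?thesis .
      next
        case False
        have "card (set u \<inter> set ys) \<le> card {x \<in> set ys. f x \<le> c - 1}"
          using u_le False by (intro card_mono) force+
        also have "\<dots> \<le> card {x \<in> set xs. f x \<le> c - 1}" using R by blast
        also have "\<dots> \<le> card (set u \<inter> set xs)"
          using set_uz z_ge by (intro card_mono) force+
        finally show ?thesis .
      qed
    qed simp
  qed
qed

section \<open>Riders at a post and the Dyck condition\<close>

definition riders :: "nat \<Rightarrow> nat mat \<Rightarrow> nat \<Rightarrow> nat set" where
  "riders n M j = {i. i < n \<and> M $$ (i, j) = 1}"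

lemma finite_riders [simp]: "finite (riders n M j)"
  by (simp add: riders_def)

lemma finite_X10 [simp]: "finite (X10 n M j)" and finite_X01 [simp]: "finite (X01 n M j)"
  by (simp_all add: X10_def X01_def)

lemma uniform_entry:
  assumes "uniform_mat n k M" "i < n" "j < n"
  shows "M $$ (i, j) = 0 \<or> M $$ (i, j) = 1"
  using assms elements_matI[of M n n i j] by (auto simp: uniform_mat_def binary_mat_def)

lemma card_riders: "uniform_mat n k M \<Longrightarrow> j < n \<Longrightarrow> card (riders n M j) = k"
  by (simp add: uniform_mat_def riders_def)

text \<open>\<open>P\<close> is left free for two uses: the trivial predicate gives equally many
  letters of each kind, and \<open>s \<le> S M i j\<close> lets the travellers cycling on both sides
  of the post cancel from the threshold inequalities.\<close>

lemma card_riders_split: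
  assumes "uniform_mat n k M" "1 \<le> j" "j < n"
  shows "card {i \<in> riders n M (j - 1). P i} =
      card {i \<in> X10 n M j. P i} + card {i \<in> riders n M (j - 1) \<inter> riders n M j. P i}"
    and "card {i \<in> riders n M j. P i} =
      card {i \<in> X01 n M j. P i} + card {i \<in> riders n M (j - 1) \<inter> riders n M j. P i}"
proof -
  have entry: "M $$ (i, j - 1) = 0 \<or> M $$ (i, j - 1) = 1" "M $$ (i, j) = 0 \<or> M $$ (i, j) = 1"
    if "i < n" for i
    using uniform_entry[OF assms(1) that] assms(2,3) by (meson less_imp_diff_less)+
  have eq10: "{i \<in> riders n M (j - 1). P i} =
      {i \<in> X10 n M j. P i} \<union> {i \<in> riders n M (j - 1) \<inter> riders n M j. P i}"
    using entry(2) by (force simp: riders_def X10_def)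
  show "card {i \<in> riders n M (j - 1). P i} =
      card {i \<in> X10 n M j. P i} + card {i \<in> riders n M (j - 1) \<inter> riders n M j. P i}"
    unfolding eq10 by (rule card_Un_disjoint) (auto simp: riders_def X10_def)
  have eq01: "{i \<in> riders n M j. P i} =
      {i \<in> X01 n M j. P i} \<union> {i \<in> riders n M (j - 1) \<inter> riders n M j. P i}"
    using entry(1) by (force simp: riders_def X01_def)
  show "card {i \<in> riders n M j. P i} =
      card {i \<in> X01 n M j. P i} + card {i \<in> riders n M (j - 1) \<inter> riders n M j. P i}"
    unfolding eq01 by (rule card_Un_disjoint) (auto simp: riders_def X01_def)
qed

lemma dyck_canonical_word_iff:
  assumes "uniform_mat n k M" "1 \<le> j" "j < n"
  shows "dyck_word (canonical_word n M j) \<longleftrightarrow>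
    (\<forall>s. card {i \<in> riders n M j. s \<le> S M i j} \<le> card {i \<in> riders n M (j - 1). s \<le> S M i j})"
proof -
  let ?A = "X10 n M j" and ?B = "X01 n M j" and ?f = "\<lambda>i. - int (S M i j)"
  let ?xs = "sorted_list_of_set ?A" and ?ys = "sorted_list_of_set ?B"
  let ?h = "\<lambda>i. if i \<in> ?A then a else b"
  let ?L = "sort_key ?f (?xs @ ?ys)"
  have disj: "?A \<inter> ?B = {}" by (auto simp: X10_def X01_def)
  have dist: "distinct (?xs @ ?ys)" using disj by simp
  \<comment> \<open>The list has no repetitions, so letters in a prefix can be counted as elements
    of sets.\<close>
  have counts: "count_list (map ?h u) a = card (set u \<inter> ?A)"
    "count_list (map ?h u) b = card (set u \<inter> ?B)" if "prefix u ?L" for u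
  proof -
    have "distinct ?L" using dist by simp
    then have du: "distinct u" using that unfolding prefix_def by (metis distinct_append)
    have su: "set u \<subseteq> ?A \<union> ?B"
      using that set_mono_prefix[of u ?L] by simp
    have count: "count_list (map ?h u) l = card (set (filter (\<lambda>i. ?h i = l) u))" for l
    proof -
      have "count_list (map ?h u) l = length (filter (\<lambda>i. ?h i = l) u)"
        by (induction u) auto
      also have "\<dots> = card (set (filter (\<lambda>i. ?h i = l) u))"
        by (rule distinct_card[symmetric]) (rule distinct_filter[OF du])
      finally show ?thesis .
    qed
    have sets: "set (filter (\<lambda>i. ?h i = a) u) = set u \<inter> ?A"
      "set (filter (\<lambda>i. ?h i = b) u) = set u \<inter> ?B"
      using su disj by auto
    show "count_list (map ?h u) a = card (set u \<inter> ?A)"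
      "count_list (map ?h u) b = card (set u \<inter> ?B)"
      by (simp_all only: count sets)
  qed
  have "card ?A = card ?B"
    using card_riders_split[OF assms, of "\<lambda>_. True"] card_riders[OF assms(1), of j]
      card_riders[OF assms(1), of "j - 1"] assms by simp
  moreover have "set ?L \<inter> ?A = ?A" "set ?L \<inter> ?B = ?B" by auto
  ultimately have "count_list (map ?h ?L) a = count_list (map ?h ?L) b"
    using counts[of ?L] by simp
  then have "dyck_word (canonical_word n M j) \<longleftrightarrow>
      (\<forall>u. prefix u ?L \<longrightarrow> card (set u \<inter> ?B) \<le> card (set u \<inter> ?A))"
    unfolding dyck_word_def canonical_word_def canonical_list_def prefix_map_iff
    using counts by auto
  also have "\<dots> \<longleftrightarrow> (\<forall>c. card {i \<in> ?B. ?f i \<le> c} \<le> card {i \<in> ?A. ?f i \<le> c})"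
    using prefix_sort_key_balance_iff[OF dist, of ?f] by simp
  also have "\<dots> \<longleftrightarrow> (\<forall>s. card {i \<in> ?B. s \<le> S M i j} \<le> card {i \<in> ?A. s \<le> S M i j})"
  proof (intro iffI allI)
    fix s
    assume "\<forall>c. card {i \<in> ?B. ?f i \<le> c} \<le> card {i \<in> ?A. ?f i \<le> c}"
    then show "card {i \<in> ?B. s \<le> S M i j} \<le> card {i \<in> ?A. s \<le> S M i j}"
      by (auto dest!: spec[of _ "- int s"])
  next
    fix c
    \<comment> \<open>Keys are negated sums, hence a key bound is a threshold on \<open>S\<close>. A
      positive \<open>c\<close> becomes the threshold 0, which all elements meet.\<close>
    have "- int m \<le> c \<longleftrightarrow> nat (- c) \<le> m" for m by linarith
    moreover assume "\<forall>s. card {i \<in> ?B. s \<le> S M i j} \<le> card {i \<in> ?A. s \<le> S M i j}"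
    ultimately show "card {i \<in> ?B. ?f i \<le> c} \<le> card {i \<in> ?A. ?f i \<le> c}" by simp
  qed
  finally show ?thesis
    by (simp only: card_riders_split[OF assms] add_le_cancel_right)
qed

section \<open>Arrival times and the handover of bicycles\<close>

lemma execution_arr:
  assumes "execution v w n k M arr dep bike" "no_waiting n arr dep"
    and "uniform_mat n k' M" "i < n" "j \<le> n"
  shows "arr i j = S M i j / v + (real j - S M i j) / w"
  using \<open>j \<le> n\<close>
proof (induction j)
  case 0
  then show ?case using assms by (simp add: execution_def S_def)
next
  case (Suc j)
  have "arr i (Suc j) = arr i j + 1 / (if M $$ (i, j) = 1 then v else w)"
    using assms Suc.prems by (simp add: execution_def no_waiting_def)
  then show ?case
    using Suc uniform_entry[OF assms(3,4), of j]
    by (auto simp: S_def add_divide_distrib diff_divide_distrib)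
qed

text \<open>The time is affine in the number of cycled stages, with slope
  \<open>1 / v - 1 / w < 0\<close>.\<close>

lemma arrival_le_iff:
  fixes v w t :: real
  assumes "0 < w" "w < v"
  shows "x / v + (t - x) / w \<le> y / v + (t - y) / w \<longleftrightarrow> y \<le> x"
proof -
  have "x / v + (t - x) / w - (y / v + (t - y) / w) = (y - x) * (1 / w - 1 / v)"
    by (simp add: algebra_simps diff_divide_distrib)
  moreover have "0 < 1 / w - 1 / v" using assms by (simp add: frac_less2)
  ultimately show ?thesis
    by (smt (verit, best) mult_pos_pos mult_nonpos_nonneg)
qed

text \<open>From a run, \<open>g i\<close> is a traveller who brought to post \<open>j\<close> the
  bicycle that \<open>i\<close> takes there. From handovers, bicycles are distributed on the first
  stage and then passed on along \<open>g\<close>.\<close>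

lemma optimal_iff_handover:
  fixes v w :: real
  assumes "0 < w" "w < v" and uni: "uniform_mat n k M"
  shows "optimal v w n M \<longleftrightarrow>
    (\<forall>j\<in>{1..n - 1}. \<exists>g. inj_on g (riders n M j) \<and> g ` riders n M j \<subseteq> riders n M (j - 1) \<and>
      (\<forall>i\<in>riders n M j. S M i j \<le> S M (g i) j))"
    (is "_ \<longleftrightarrow> (\<forall>j\<in>_. \<exists>g. ?handover j g)")
proof
  assume "optimal v w n M"
  then obtain k' arr dep bike where
    uni': "uniform_mat n k' M" and ex: "execution v w n k' M arr dep bike"
    and nw: "no_waiting n arr dep"
    by (auto simp: optimal_def)
  show "\<forall>j\<in>{1..n - 1}. \<exists>g. ?handover j g"
  proof
    fix j assume "j \<in> {1..n - 1}"
    then have j: "1 \<le> j" "j < n" by auto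
    \<comment> \<open>By \<open>bike_at\<close>, neither of two riders of one bicycle may leave
      after the other, so they would set off together, which \<open>execution\<close>
      forbids.\<close>
    have inj: "i = i'" if "i \<in> riders n M j" "i' \<in> riders n M j" "bike i j = bike i' j" for i i'
    proof -
      have "dep i j \<le> dep i' j" "dep i' j \<le> dep i j"
        using ex that j unfolding execution_def bike_at_def riders_def by auto
      then have "dep i j = dep i' j" by simp
      moreover have "M $$ (i, j) = 1 \<and> M $$ (i', j) = 1 \<and> i \<noteq> i' \<longrightarrow>
          \<not> (bike i j = bike i' j \<and> dep i j = dep i' j)"
        using ex that j unfolding execution_def riders_def by blast
      ultimately show ?thesis using that by (auto simp: riders_def)
    qed
    have "\<exists>i' \<in> riders n M (j - 1). bike i' (j - 1) = bike i j \<and> S M i j \<le> S M i' j"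
      if "i \<in> riders n M j" for i
    proof -
      have i: "i < n" "M $$ (i, j) = 1" using that by (auto simp: riders_def)
      then have "bike_at n M arr dep bike (bike i j) j (dep i j)"
        using ex j by (simp add: execution_def)
      then obtain i' where i': "i' < n" "M $$ (i', j - 1) = 1" "bike i' (j - 1) = bike i j"
        "arr i' j \<le> dep i j"
        using j by (auto simp: bike_at_def)
      then have "arr i' j \<le> arr i j" using nw i j by (simp add: no_waiting_def)
      then have "real (S M i j) \<le> real (S M i' j)"
        using execution_arr[OF ex nw uni'] i i' j arrival_le_iff[OF assms(1,2)] by simp
      then show ?thesis using i' by (auto simp: riders_def)
    qed
    then obtain g where g: "\<And>i. i \<in> riders n M j \<Longrightarrow>
        g i \<in> riders n M (j - 1) \<and> bike (g i) (j - 1) = bike i j \<and> S M i j \<le> S M (g i) j"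
      by metis
    have "inj_on g (riders n M j)"
      using g inj by (metis inj_onI)
    then show "\<exists>g. ?handover j g" using g by blast
  qed
next
  assume "\<forall>j\<in>{1..n - 1}. \<exists>g. ?handover j g"
  then obtain g where g: "\<And>j. j \<in> {1..n - 1} \<Longrightarrow> ?handover j (g j)" by metis
  have "\<exists>h. inj_on h (riders n M 0) \<and> h ` riders n M 0 \<subseteq> {..<k}"
  proof (cases "n = 0")
    case True
    then show ?thesis by (simp add: riders_def)
  next
    case False
    then have "card (riders n M 0) = card {..<k}" using card_riders[OF uni] by simp
    then show ?thesis by (metis finite_same_card_bij finite_riders finite_lessThan bij_betw_def order_refl)
  qed
  then obtain h where h: "inj_on h (riders n M 0)" "h ` riders n M 0 \<subseteq> {..<k}" by blast
  \<comment> \<open>Rider \<open>i\<close> of stage \<open>j\<close> is traced back through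
    \<open>g j\<close>, ..., \<open>g 1\<close> to a rider of the first stage, whose bicycle under
    \<open>h\<close> he inherits. The stage is the first argument because the recursion changes the
    traveller.\<close>
  define bk where "bk = rec_nat h (\<lambda>j f i. f (g (Suc j) i))"
  have bk_0: "bk 0 = h" and bk_Suc: "bk (Suc j) i = bk j (g (Suc j) i)" for j i
    by (simp_all add: bk_def)
  have bk: "inj_on (bk j) (riders n M j) \<and> bk j ` riders n M j \<subseteq> {..<k}" if "j < n" for j
    using that
  proof (induction j)
    case 0
    then show ?case using h bk_0 by simp
  next
    case (Suc j)
    have gj: "?handover (Suc j) (g (Suc j))" using Suc.prems by (intro g) auto
    have eq: "bk (Suc j) = bk j \<circ> g (Suc j)" by (auto simp: bk_Suc)
    have "inj_on (bk j) (g (Suc j) ` riders n M (Suc j))"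
      using Suc gj by (auto intro: inj_on_subset)
    then have "inj_on (bk (Suc j)) (riders n M (Suc j))"
      unfolding eq using gj by (intro comp_inj_on) auto
    moreover have "bk (Suc j) ` riders n M (Suc j) \<subseteq> {..<k}"
      unfolding eq image_comp[symmetric] using Suc gj by (auto 4 4)
    ultimately show ?case by blast
  qed
  \<comment> \<open>The timetable without waiting, used for both arrivals and departures.\<close>
  define T where "T = (\<lambda>i j. S M i j / v + (real j - S M i j) / w)"
  have T_le: "T i j \<le> T i' j \<longleftrightarrow> S M i' j \<le> S M i j" for i i' j
    using arrival_le_iff[OF assms(1,2)] by (simp add: T_def)
  have T_Suc: "T i (Suc j) = T i j + 1 / (if M $$ (i, j) = 1 then v else w)"
    if "i < n" "j < n" for i j
    using uniform_entry[OF uni that]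
    by (auto simp: T_def S_def add_divide_distrib diff_divide_distrib)
  have bike_at: "bike_at n M T T (\<lambda>i j. bk j i) (bk j i) j (T i j)"
    if ij: "i < n" "j < n" "M $$ (i, j) = 1" for i j
    unfolding bike_at_def
  proof (intro conjI)
    have i: "i \<in> riders n M j" using ij by (simp add: riders_def)
    \<comment> \<open>The bicycle cannot have left earlier: by injectivity of \<open>bk j\<close>,
      only \<open>i\<close> rides it on this stage.\<close>
    show "\<forall>i'<n. M $$ (i', j) = 1 \<and> bk j i' = bk j i \<longrightarrow> T i j \<le> T i' j"
    proof (intro allI impI)
      fix i' assume "i' < n" "M $$ (i', j) = 1 \<and> bk j i' = bk j i"
      then have "i' = i" using bk[OF ij(2)] i by (auto simp: inj_on_def riders_def)
      then show "T i j \<le> T i' j" by simp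
    qed
    show "j = 0 \<or> (\<exists>i'<n. M $$ (i', j - 1) = 1 \<and> bk (j - 1) i' = bk j i \<and> T i' j \<le> T i j)"
    proof (cases j)
      case (Suc j')
      have "?handover j (g j)" using ij Suc by (intro g) auto
      then have "g j i \<in> riders n M (j - 1)" "S M i j \<le> S M (g j i) j" using i by auto
      moreover have "bk (j - 1) (g j i) = bk j i" using bk_Suc[of j' i] Suc by simp
      ultimately show ?thesis using T_le by (auto simp: riders_def)
    qed simp
  qed
  have "execution v w n k M T T (\<lambda>i j. bk j i)"
    unfolding execution_def
  proof (intro conjI)
    show "\<forall>i<n. T i 0 = 0" by (simp add: T_def S_def)
    show "\<forall>i<n. \<forall>j<n. M $$ (i, j) = 1 \<longrightarrow>
        bk j i < k \<and> bike_at n M T T (\<lambda>i j. bk j i) (bk j i) j (T i j)"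
    proof (intro allI impI conjI)
      fix i j assume ij: "i < n" "j < n" "M $$ (i, j) = 1"
      have "bk j i \<in> bk j ` riders n M j" using ij by (simp add: riders_def)
      then show "bk j i < k" using bk[OF ij(2)] by blast
      show "bike_at n M T T (\<lambda>i j. bk j i) (bk j i) j (T i j)" using ij by (rule bike_at)
    qed
    show "\<forall>i<n. \<forall>i'<n. \<forall>j<n. M $$ (i, j) = 1 \<and> M $$ (i', j) = 1 \<and> i \<noteq> i' \<longrightarrow>
        \<not> (bk j i = bk j i' \<and> T i j = T i' j)"
    proof (intro allI impI notI)
      fix i i' j
      assume ij: "i < n" "i' < n" "j < n" "M $$ (i, j) = 1 \<and> M $$ (i', j) = 1 \<and> i \<noteq> i'"
        and "bk j i = bk j i' \<and> T i j = T i' j"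
      then have "i = i'" using bk[OF ij(3)] by (auto simp: riders_def dest: inj_onD)
      then show False using ij(4) by simp
    qed
  qed (simp_all add: T_Suc)
  moreover have "no_waiting n T T" by (simp add: no_waiting_def)
  ultimately show "optimal v w n M" using uni by (auto simp: optimal_def)
qed

theorem theorem3p7:
  fixes v w :: real and n k :: nat and M :: "nat mat"
  assumes "0 < w" and "w < v"
    and "uniform_mat n k M"
  shows "optimal v w n M \<longleftrightarrow> (\<forall>j\<in>{1..n - 1}. dyck_word (canonical_word n M j))"
  unfolding optimal_iff_handover[OF assms]
proof (rule ball_cong[OF refl])
  fix j assume "j \<in> {1..n - 1}"
  then have j: "1 \<le> j" "j < n" by auto
  show "(\<exists>g. inj_on g (riders n M j) \<and> g ` riders n M j \<subseteq> riders n M (j - 1) \<and>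
      (\<forall>i\<in>riders n M j. S M i j \<le> S M (g i) j)) \<longleftrightarrow> dyck_word (canonical_word n M j)"
    \<comment> \<open>Both sides reduce to the same threshold inequalities between consecutive
      columns.\<close>
    using ex_inj_on_ge_iff[of "riders n M (j - 1)" "riders n M j" "\<lambda>i. S M i j"]
      dyck_canonical_word_iff[OF assms(3) j] by simp
qed

end
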